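(* For every integer $t \ge 0$ and every set $X$ with $|X| \ge 2$, $f(t;X) = 2^{t+1}$.
   Context: For $p,q \in X^n$, $\mathrm{dist}(p,q)$ is the Hamming distance, i.e. the number of coordinates in which $p$ and $q$ differ. $f(t;X)$ is defined as the maximum $m$ such that there exist an integer $n > t$ and $a_1,\dots,a_m,b_1,\dots,b_m \in X^n$ with $\mathrm{dist}(a_i,b_i) \ge t+1$ for all $i \in [m]$ and $\mathrm{dist}(a_i,b_j) \le t$ for all distinct $i,j \in [m]$. *)

theory Defs
  imports Main "HOL-Library.FuncSet"
begin

text \<open>
  The power \<open>X\<^sup>n\<close> is the set of extensional functions \<open>{..<n} \<rightarrow>\<^sub>E X\<close>, so coordinates are indexed
  by \<open>0, \<dots>, n - 1\<close>; the alphabet \<open>X\<close> is an arbitrary, possibly infinite, set.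
\<close>

definition hamming_dist :: "nat \<Rightarrow> (nat \<Rightarrow> 'a) \<Rightarrow> (nat \<Rightarrow> 'a) \<Rightarrow> nat" where
  "hamming_dist n p q = card {k \<in> {..<n}. p k \<noteq> q k}"

definition attainable :: "nat \<Rightarrow> 'a set \<Rightarrow> nat \<Rightarrow> bool" where
  "attainable t X m \<longleftrightarrow>
     (\<exists>n > t. \<exists>a b :: nat \<Rightarrow> nat \<Rightarrow> 'a.
        (\<forall>i \<in> {1..m}. a i \<in> {..<n} \<rightarrow>\<^sub>E X \<and> b i \<in> {..<n} \<rightarrow>\<^sub>E X) \<and>
        (\<forall>i \<in> {1..m}. hamming_dist n (a i) (b i) \<ge> t + 1) \<and>
        (\<forall>i \<in> {1..m}. \<forall>j \<in> {1..m}. i \<noteq> j \<longrightarrow> hamming_dist n (a i) (b j) \<le> t))"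

text \<open>
  \<^const>\<open>Greatest\<close> is unspecified if there is no maximum, so a statement about \<open>max_pairs\<close> should
  also assert that the maximum exists.
\<close>

definition max_pairs :: "nat \<Rightarrow> 'a set \<Rightarrow> nat" where
  "max_pairs t X = (GREATEST m. attainable t X m)"

end

theory Submission
  imports Defs Complex_Main
begin

text \<open>
  The lower bound comes from all words of length \<open>t + 1\<close> over two letters, paired with their
  complements. For the upper bound, take the letters to be real numbers and consider the words
  obtained from \<open>b\<^sub>i\<close> and \<open>a\<^sub>j\<close> by overwriting the coordinates in \<open>P\<close>, respectively \<open>Q\<close>,
  with a wildcard. The product over all coordinates of \<open>a\<^sub>j - b\<^sub>i\<close>, where a wildcard pairs to 1
  with a letter and to 0 with a wildcard, is a sum of \<open>2\<^sup>n\<close> products of a function of \<open>(i, P)\<close> and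
  a function of \<open>(j, Q)\<close>. It vanishes for \<open>i \<noteq> j\<close> unless \<open>P\<close> and \<open>Q\<close> are disjoint and together
  have at least \<open>n - t\<close> elements. For each \<open>i\<close> let \<open>P\<close> be arbitrary outside the set \<open>D\<^sub>i\<close> of
  coordinates where \<open>a\<^sub>i\<close> and \<open>b\<^sub>i\<close> differ, and light on \<open>D\<^sub>i\<close>. The resulting matrix is then
  block triangular with nonsingular diagonal blocks, and every \<open>i\<close> contributes at least
  \<open>2 ^ (n - t - 1)\<close> rows, so there are at most \<open>2 ^ (t + 1)\<close> pairs.
\<close>

section \<open>Linear dependence by elimination\<close>

lemma nontrivial_linear_relation:
  fixes u :: "'i \<Rightarrow> 'z \<Rightarrow> 'f::field"
  assumes "finite Z" "finite J" "card Z < card J"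
  shows "\<exists>c. (\<exists>i\<in>J. c i \<noteq> 0) \<and> (\<forall>z\<in>Z. (\<Sum>i\<in>J. c i * u i z) = 0)"
  using assms
proof (induction Z arbitrary: J u rule: finite_induct)
  case empty
  then show ?case by (intro exI[of _ "\<lambda>_. 1"]) (auto simp: card_gt_0_iff)
next
  case (insert z Z)
  show ?case
  proof (cases "\<forall>i\<in>J. u i z = 0")
    case True
    from insert.IH[OF insert.prems(1), of u] insert.prems insert.hyps
    obtain c where "\<exists>i\<in>J. c i \<noteq> 0" "\<forall>z\<in>Z. (\<Sum>i\<in>J. c i * u i z) = 0"
      by auto
    with True show ?thesis by (intro exI[of _ c]) auto
  next
    case False
    then obtain p where p: "p \<in> J" "u p z \<noteq> 0" by auto
    define K where "K = J - {p}"
    define r where "r i = u i z / u p z" for i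
    have J: "J = insert p K" "p \<notin> K" "finite K"
      using p insert.prems by (auto simp: K_def)
    have "card Z < card K"
      using insert.prems insert.hyps J by simp
    from insert.IH[OF \<open>finite K\<close> this, of "\<lambda>i y. u i y - r i * u p y"]
    obtain c where c: "\<exists>i\<in>K. c i \<noteq> 0"
      "\<forall>y\<in>Z. (\<Sum>i\<in>K. c i * (u i y - r i * u p y)) = 0" by auto
    \<comment> \<open>The pivot \<open>p\<close> absorbs the multiples subtracted from the other
      vectors, so a relation among the reduced vectors lifts to the original ones.\<close>
    define c' where "c' = c(p := - (\<Sum>i\<in>K. c i * r i))"
    have sum_c': "(\<Sum>i\<in>J. c' i * u i y) = (\<Sum>i\<in>K. c i * (u i y - r i * u p y))" for y
    proof -
      have "(\<Sum>i\<in>K. c' i * u i y) = (\<Sum>i\<in>K. c i * u i y)"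
        using J by (intro sum.cong) (auto simp: c'_def)
      then have "(\<Sum>i\<in>J. c' i * u i y) = (\<Sum>i\<in>K. c i * u i y) - (\<Sum>i\<in>K. c i * r i) * u p y"
        using J by (simp add: c'_def)
      also have "\<dots> = (\<Sum>i\<in>K. c i * (u i y - r i * u p y))"
        by (simp add: right_diff_distrib sum_subtractf sum_distrib_right mult.assoc)
      finally show ?thesis .
    qed
    have "\<exists>i\<in>J. c' i \<noteq> 0"
      using c(1) J by (auto simp: c'_def)
    moreover have "(\<Sum>i\<in>J. c' i * u i y) = 0" if "y \<in> insert z Z" for y
      using that c(2) p by (auto simp: sum_c' r_def)
    ultimately show ?thesis by blast
  qed
qed

section \<open>The wildcard pairing\<close>

text \<open>\<open>P\<close> and \<open>Q\<close> are the wildcard positions of the two words, and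
  \<open>x\<close> will be the coordinatewise difference of their letters.\<close>

definition entry :: "nat set \<Rightarrow> nat set \<Rightarrow> (nat \<Rightarrow> real) \<Rightarrow> nat \<Rightarrow> real" where
  "entry P Q x k = (if k \<in> P then (if k \<in> Q then 0 else 1) else if k \<in> Q then 1 else x k)"

lemma prod_entry_nonzero:
  assumes "finite A" "(\<Prod>k\<in>A. entry P Q x k) \<noteq> 0" "k \<in> A"
  shows "k \<notin> P \<or> k \<notin> Q" "k \<in> P \<or> k \<in> Q \<or> x k \<noteq> 0"
  using assms by (auto simp: entry_def prod_zero_iff split: if_splits)

text \<open>A wildcard and the letters are encoded as vectors in the plane, for which
  \<open>x - y\<close> is the inner product of \<open>(x, 1)\<close> and \<open>(1, - y)\<close>.\<close>

lemma prod_entry_factorization: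
  fixes a b :: "nat \<Rightarrow> real"
  assumes "finite A"
  shows "\<exists>u v. \<forall>P Q x y. (\<Prod>k\<in>A. entry P Q (\<lambda>k. x k - y k) k)
    = (\<Sum>Z\<in>Pow A. u P y Z * v Q x Z)"
proof (intro exI allI)
  fix P Q :: "nat set" and x y :: "nat \<Rightarrow> real"
  have "(\<Prod>k\<in>A. entry P Q (\<lambda>k. x k - y k) k) =
      (\<Prod>k\<in>A. (if k \<in> P then 0 else 1) * (if k \<in> Q then 1 else x k) +
            (if k \<in> P then 1 else - y k) * (if k \<in> Q then 0 else 1))"
    by (intro prod.cong) (auto simp: entry_def)
  also have "\<dots> = (\<Sum>Z\<in>Pow A.
      ((\<Prod>k\<in>Z. if k \<in> P then 0 else 1) * (\<Prod>k\<in>A - Z. if k \<in> P then 1 else - y k)) *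
      ((\<Prod>k\<in>Z. if k \<in> Q then 1 else x k) * (\<Prod>k\<in>A - Z. if k \<in> Q then 0 else 1)))"
    unfolding prod_add[OF assms] prod.distrib by (intro sum.cong) (auto simp: mult_ac)
  finally show "(\<Prod>k\<in>A. entry P Q (\<lambda>k. x k - y k) k) = (\<Sum>Z\<in>Pow A.
      (\<lambda>P y Z. (\<Prod>k\<in>Z. if k \<in> P then 0 else 1) * (\<Prod>k\<in>A - Z. if k \<in> P then 1 else - y k)) P y Z *
      (\<lambda>Q x Z. (\<Prod>k\<in>Z. if k \<in> Q then 1 else x k) * (\<Prod>k\<in>A - Z. if k \<in> Q then 0 else 1)) Q x Z)"
    by simp
qed

text \<open>The combination of columns replaces the factor \<open>x k\<close> by 0 for \<open>k \<in> S\<close> outside \<open>P\<close>.\<close>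

lemma sum_Pow_entry:
  assumes "finite D" "S \<subseteq> D"
  shows "(\<Sum>Q\<in>Pow S. (\<Prod>k\<in>Q. - x k) * (\<Prod>k\<in>D. entry P Q x k))
    = (if S \<subseteq> P then \<Prod>k\<in>D - P. x k else 0)"
proof -
  have S: "finite S" using assms finite_subset by blast
  \<comment> \<open>\<open>?f + ?g\<close> is 1 on \<open>P\<close> and 0 elsewhere; expanding its
    product over \<open>S\<close> yields the sum over \<open>Q\<close>.\<close>
  let ?f = "\<lambda>k. if k \<in> P then 0 else - x k" and ?g = "\<lambda>k. if k \<in> P then 1 else x k"
  have "(\<Prod>k\<in>Q. - x k) * (\<Prod>k\<in>D. entry P Q x k) =
      (\<Prod>k\<in>Q. ?f k) * (\<Prod>k\<in>S - Q. ?g k) * (\<Prod>k\<in>D - S. ?g k)" if "Q \<in> Pow S" for Q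
  proof -
    have "(\<Prod>k\<in>D. entry P Q x k) = (\<Prod>k\<in>D - S. entry P Q x k) * (\<Prod>k\<in>S. entry P Q x k)"
      using assms by (intro prod.subset_diff) auto
    also have "(\<Prod>k\<in>S. entry P Q x k) = (\<Prod>k\<in>S - Q. entry P Q x k) * (\<Prod>k\<in>Q. entry P Q x k)"
      using that S by (intro prod.subset_diff) auto
    also have "(\<Prod>k\<in>D - S. entry P Q x k) = (\<Prod>k\<in>D - S. ?g k)"
      using that by (intro prod.cong) (auto simp: entry_def)
    also have "(\<Prod>k\<in>S - Q. entry P Q x k) = (\<Prod>k\<in>S - Q. ?g k)"
      by (intro prod.cong) (auto simp: entry_def)
    finally have "(\<Prod>k\<in>Q. - x k) * (\<Prod>k\<in>D. entry P Q x k) =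
        ((\<Prod>k\<in>Q. - x k) * (\<Prod>k\<in>Q. entry P Q x k)) * (\<Prod>k\<in>S - Q. ?g k) * (\<Prod>k\<in>D - S. ?g k)"
      by (simp only: mult_ac)
    also have "(\<Prod>k\<in>Q. - x k) * (\<Prod>k\<in>Q. entry P Q x k) = (\<Prod>k\<in>Q. ?f k)"
      unfolding prod.distrib[symmetric] by (intro prod.cong) (auto simp: entry_def)
    finally show ?thesis .
  qed
  then have "(\<Sum>Q\<in>Pow S. (\<Prod>k\<in>Q. - x k) * (\<Prod>k\<in>D. entry P Q x k)) =
      (\<Prod>k\<in>S. ?f k + ?g k) * (\<Prod>k\<in>D - S. ?g k)"
    unfolding prod_add[OF S] sum_distrib_right by (intro sum.cong) auto
  also have "\<dots> = (if S \<subseteq> P then \<Prod>k\<in>D - P. x k else 0)"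
  proof (cases "S \<subseteq> P")
    case True
    have "(\<Prod>k\<in>D - S. ?g k) = (\<Prod>k\<in>D - P. ?g k)"
      using assms True by (intro prod.mono_neutral_right) auto
    also have "\<dots> = (\<Prod>k\<in>D - P. x k)"
      by (intro prod.cong) auto
    moreover have "(\<Prod>k\<in>S. ?f k + ?g k) = 1"
      using True by (intro prod.neutral) auto
    ultimately show ?thesis using True by simp
  next
    case False
    then have "(\<Prod>k\<in>S. ?f k + ?g k) = 0"
      using S by (intro prod_zero) auto
    then show ?thesis using False by simp
  qed
  finally show ?thesis .
qed

text \<open>Let \<open>T\<close> be maximal in the support of \<open>c\<close>. Down-closedness
  provides all columns \<open>Q \<subseteq> T\<close>, and combining them as in
  \<open>sum_Pow_entry\<close> kills every row except the supersets of \<open>T\<close>. Only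
  \<open>c T\<close> survives, with a nonzero factor.\<close>

lemma down_closed_entry_nonsingular:
  assumes D: "finite D" "\<And>k. k \<in> D \<Longrightarrow> x k \<noteq> 0"
    and F: "F \<subseteq> Pow D" "\<And>P Q. P \<in> F \<Longrightarrow> Q \<subseteq> P \<Longrightarrow> Q \<in> F"
    and eq: "\<And>Q. Q \<in> F \<Longrightarrow> (\<Sum>P\<in>F. c P * (\<Prod>k\<in>D. entry P Q x k)) = 0"
    and "S \<in> F"
  shows "c S = 0"
proof (rule ccontr)
  assume "c S \<noteq> 0"
  have finF: "finite F" using D(1) F(1) by (meson finite_Pow_iff finite_subset)
  let ?N = "{P \<in> F. c P \<noteq> 0}"
  have "finite ?N" "?N \<noteq> {}" using finF \<open>S \<in> F\<close> \<open>c S \<noteq> 0\<close> by auto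
  then obtain T where T: "T \<in> ?N" "\<And>P. P \<in> ?N \<Longrightarrow> T \<subseteq> P \<Longrightarrow> P = T"
    using finite_has_maximal[of ?N] by (metis (no_types, lifting))
  have "0 = (\<Sum>Q\<in>Pow T. (\<Prod>k\<in>Q. - x k) * (\<Sum>P\<in>F. c P * (\<Prod>k\<in>D. entry P Q x k)))"
    using eq F(2) T(1) by (intro sum.neutral[symmetric]) auto
  also have "\<dots> = (\<Sum>P\<in>F. c P * (\<Sum>Q\<in>Pow T. (\<Prod>k\<in>Q. - x k) * (\<Prod>k\<in>D. entry P Q x k)))"
    unfolding sum_distrib_left by (subst sum.swap) (simp add: mult_ac)
  also have "\<dots> = (\<Sum>P\<in>F. c P * (if T \<subseteq> P then \<Prod>k\<in>D - P. x k else 0))"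
    using F(1) T(1) by (subst sum_Pow_entry[OF D(1)]) auto
  also have "\<dots> = (\<Sum>P\<in>{T}. c P * (if T \<subseteq> P then \<Prod>k\<in>D - P. x k else 0))"
    using T finF by (intro sum.mono_neutral_right) auto
  finally show False using T(1) D by auto
qed

section \<open>Elementary counting estimates\<close>

text \<open>For each \<open>P \<subseteq> R\<close>, the family contains \<open>P\<close> or
  \<open>R - P\<close>; membership of \<open>k\<close> settles the case of equal sizes.\<close>

lemma two_power_card_half:
  assumes "finite R" "k \<in> R"
  shows "2 ^ (card R - 1) \<le>
    card {P. P \<subseteq> R \<and> (2 * card P < card R \<or> 2 * card P = card R \<and> k \<in> P)}" (is "_ \<le> card ?G")
proof -
  have fin: "finite ?G" using assms(1) by (auto intro: finite_subset[of _ "Pow R"])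
  have "Pow R \<subseteq> ?G \<union> (\<lambda>P. R - P) ` ?G"
  proof
    fix P assume "P \<in> Pow R"
    then have P: "P \<subseteq> R" "R - (R - P) = P" by auto
    then have "card (R - P) = card R - card P" "card P \<le> card R"
      using assms(1) by (simp_all add: card_Diff_subset card_mono finite_subset[OF P(1)])
    then have "P \<in> ?G \<or> R - P \<in> ?G"
      using P assms(2) by auto
    then show "P \<in> ?G \<union> (\<lambda>P. R - P) ` ?G"
    proof
      assume "R - P \<in> ?G"
      then show "P \<in> ?G \<union> (\<lambda>P. R - P) ` ?G" by (intro UnI2 image_eqI[of _ _ "R - P"] P(2)[symmetric])
    qed (rule UnI1)
  qed
  then have "card (Pow R) \<le> card (?G \<union> (\<lambda>P. R - P) ` ?G)"
    using fin by (intro card_mono) auto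
  also have "\<dots> \<le> card ?G + card ((\<lambda>P. R - P) ` ?G)"
    by (rule card_Un_le)
  also have "\<dots> \<le> 2 * card ?G"
    using card_image_le[OF fin, of "\<lambda>P. R - P"] by simp
  finally have "2 ^ card R \<le> 2 * card ?G"
    using assms(1) by (simp add: card_Pow)
  moreover have "(2::nat) ^ card R = 2 * 2 ^ (card R - 1)"
    using assms by (simp add: power_eq_if) blast
  ultimately show ?thesis by simp
qed

text \<open>This keeps the total perturbation of a set of coordinates below twice that of its
  smallest element.\<close>

lemma sum_two_power_less:
  "k \<le> n \<Longrightarrow> (\<Sum>l\<in>{k..<n}. (2::int) ^ (n - l)) < 2 ^ (n - k + 1)"
proof (induction k rule: inc_induct)
  case base
  then show ?case by simp
next
  case (step k)
  have "(2::int) ^ (n - k) = 2 ^ (n - Suc k + 1)"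
    using step.hyps by (simp add: Suc_diff_Suc)
  with step show ?case
    by (simp add: sum.atLeast_Suc_lessThan)
qed

section \<open>The upper bound for real words\<close>

locale separated_pairs =
  fixes n t :: nat and I :: "'i set" and a b :: "'i \<Rightarrow> nat \<Rightarrow> real"
  assumes finite_I: "finite I"
    and far: "i \<in> I \<Longrightarrow> t + 1 \<le> hamming_dist n (a i) (b i)"
    and near: "i \<in> I \<Longrightarrow> j \<in> I \<Longrightarrow> i \<noteq> j \<Longrightarrow> hamming_dist n (a i) (b j) \<le> t"
begin

definition diff :: "'i \<Rightarrow> nat set" where
  "diff i = {k \<in> {..<n}. a i k \<noteq> b i k}"

text \<open>
  The weights are almost constant. With constant weights, half of the balanced sets needed in
  \<open>card_light\<close> would be missing when \<open>card (diff i) - t\<close> is even; the perturbation breaks these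
  ties in favour of the sets containing the smallest coordinate of \<open>diff i\<close>.
\<close>

definition weight :: "nat set \<Rightarrow> int" where
  "weight A = (\<Sum>k\<in>A. 2 ^ (n + 1) - 2 ^ (n - k))"

text \<open>With all weights 1 and \<open>i\<close> in \<open>I\<close>, the condition would read
  \<open>2 * card P + t < card (diff i)\<close>. The set \<open>C\<close> will be the coordinates
  where neither word has a wildcard.\<close>

definition light :: "'i \<Rightarrow> nat set set" where
  "light i = {P. P \<subseteq> diff i \<and>
     (\<forall>C. C \<subseteq> {..<n} \<longrightarrow> card C \<le> t \<longrightarrow> 2 * weight P + weight C < weight (diff i))}"

definition rows :: "'i \<Rightarrow> nat set set" where
  "rows i = {P. P \<subseteq> {..<n} \<and> P \<inter> diff i \<in> light i}"

text \<open>For \<open>P\<close> within \<open>{..<n}\<close>, this is the weight of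
  \<open>P\<close> outside \<open>diff i\<close> minus the weight of its complement there, so
  complementing that part of \<open>P\<close> negates the level.\<close>

definition level :: "'i \<Rightarrow> nat set \<Rightarrow> int" where
  "level i P = 2 * weight (P - diff i) - weight ({..<n} - diff i)"

abbreviation pairing :: "'i \<Rightarrow> nat set \<Rightarrow> 'i \<Rightarrow> nat set \<Rightarrow> real" where
  "pairing i P j Q \<equiv> \<Prod>k<n. entry P Q (\<lambda>k. a j k - b i k) k"

lemma diff_subset: "diff i \<subseteq> {..<n}" and finite_diff: "finite (diff i)"
  by (auto simp: diff_def)

lemma card_diff: "i \<in> I \<Longrightarrow> t + 1 \<le> card (diff i)"
  using far by (simp add: diff_def hamming_dist_def)

lemma weight_disjoint:
  "finite A \<Longrightarrow> finite B \<Longrightarrow> A \<inter> B = {} \<Longrightarrow> weight (A \<union> B) = weight A + weight B"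
  unfolding weight_def by (rule sum.union_disjoint)

lemma weight_Diff: "finite A \<Longrightarrow> B \<subseteq> A \<Longrightarrow> weight (A - B) = weight A - weight B"
  unfolding weight_def by (rule sum_diff)

lemma weight_mono:
  assumes "finite B" "A \<subseteq> B"
  shows "weight A \<le> weight B"
proof -
  have "(2::int) ^ (n - k) \<le> 2 ^ (n + 1)" for k
    by (intro power_increasing) auto
  then show ?thesis
    unfolding weight_def using assms by (intro sum_mono2) auto
qed

lemma weight_alt: "weight A = 2 ^ (n + 1) * int (card A) - (\<Sum>k\<in>A. 2 ^ (n - k))"
  by (simp add: weight_def sum_subtractf)

lemma light_down_closed:
  assumes "P \<in> light i" "Q \<subseteq> P"
  shows "Q \<in> light i"
proof -
  have "weight Q \<le> weight P"
    using assms finite_diff by (intro weight_mono) (auto simp: light_def intro: finite_subset)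
  then have "2 * weight Q + c < d" if "2 * weight P + c < d" for c d
    using that by linarith
  with assms show ?thesis unfolding light_def by blast
qed

text \<open>Removing \<open>t\<close> coordinates other than the smallest from \<open>diff i\<close>
  leaves \<open>R\<close>. Subsets of less than half of \<open>R\<close> are light, and so are those
  of exactly half containing the smallest coordinate.\<close>

lemma card_light:
  assumes "i \<in> I"
  shows "2 ^ (card (diff i) - t - 1) \<le> card (light i)"
proof -
  let ?D = "diff i"
  let ?e = "\<lambda>A. \<Sum>k\<in>A. (2::int) ^ (n - k)"
  note d = card_diff[OF assms]
  define k where "k = Min ?D"
  have k: "k \<in> ?D" "k < n" "?D \<subseteq> {k..<n}"
  proof -
    have "?D \<noteq> {}" using d by auto
    then show "k \<in> ?D" using finite_diff by (simp add: k_def)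
    then show "k < n" using diff_subset by auto
    show "?D \<subseteq> {k..<n}" using diff_subset[of i] finite_diff[of i] by (auto simp: k_def)
  qed
  have "t \<le> card (?D - {k})" using d k finite_diff by (simp add: card_Diff_singleton)
  then obtain T where T: "T \<subseteq> ?D - {k}" "card T = t" "finite T"
    by (rule obtain_subset_with_card_n)
  define R where "R = ?D - T"
  have R: "k \<in> R" "finite R" "card R = card ?D - t"
    using T k finite_diff card_Diff_subset[of T ?D] by (auto simp: R_def)
  have eD: "?e ?D < 2 * 2 ^ (n - k)"
  proof -
    have "?e ?D \<le> ?e {k..<n}" using k by (intro sum_mono2) auto
    also have "\<dots> < 2 ^ (n - k + 1)" using k by (intro sum_two_power_less) auto
    finally show ?thesis by simp
  qed
  have N: "2 * 2 ^ (n - k) \<le> (2::int) ^ (n + 1)"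
    using k by (simp add: power_increasing)
  have "{P. P \<subseteq> R \<and> (2 * card P < card R \<or> 2 * card P = card R \<and> k \<in> P)} \<subseteq> light i"
  proof (clarsimp simp: light_def, intro conjI allI impI)
    fix P assume "P \<subseteq> R" then show "P \<subseteq> ?D" by (auto simp: R_def)
  next
    fix P C
    assume P: "P \<subseteq> R" "2 * card P < card R \<or> 2 * card P = card R \<and> k \<in> P"
      and C: "C \<subseteq> {..<n}" "card C \<le> t"
    have nonneg: "0 \<le> ?e A" for A :: "nat set" by (intro sum_nonneg) auto
    show "2 * weight P + weight C < weight ?D"
    proof (cases "2 * card P < card R")
      case True
      \<comment> \<open>A gap of one unit \<open>2 ^ (n + 1)\<close> exceeds the perturbation of
        \<open>?D\<close>.\<close>
      then have "2 * int (card P) + int (card C) \<le> int (card ?D) - 1"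
        using C R(3) d by linarith
      then have "(2::int) ^ (n + 1) * (2 * int (card P) + int (card C))
          \<le> 2 ^ (n + 1) * (int (card ?D) - 1)"
        by (intro mult_left_mono) auto
      then show ?thesis
        using nonneg[of P] nonneg[of C] eD N unfolding weight_alt right_diff_distrib distrib_left
        by linarith
    next
      case False
      with P have "k \<in> P" "2 * int (card P) + int (card C) \<le> int (card ?D)"
        using C R(3) d by auto
      then have "(2::int) ^ (n + 1) * (2 * int (card P) + int (card C))
          \<le> 2 ^ (n + 1) * int (card ?D)"
        by (intro mult_left_mono) auto
      \<comment> \<open>The perturbation at \<open>k\<close> alone, doubled by
        \<open>2 * weight P\<close>, exceeds that of \<open>?D\<close>.\<close>
      moreover have "2 ^ (n - k) \<le> ?e P"
        using P R \<open>k \<in> P\<close> by (intro member_le_sum) (auto intro: finite_subset)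
      ultimately show ?thesis
        using nonneg[of C] eD unfolding weight_alt right_diff_distrib distrib_left
        by linarith
    qed
  qed
  moreover have "finite (light i)"
    using finite_diff by (auto simp: light_def intro: finite_subset[of _ "Pow (diff i)"])
  ultimately have "card {P. P \<subseteq> R \<and> (2 * card P < card R \<or> 2 * card P = card R \<and> k \<in> P)}
      \<le> card (light i)"
    by (rule card_mono[rotated])
  with two_power_card_half[OF R(2,1)] R(3) show ?thesis by simp
qed

lemma finite_rows: "finite (rows i)"
  by (auto simp: rows_def intro: finite_subset[of _ "Pow {..<n}"])

text \<open>A row is an arbitrary set outside \<open>diff i\<close> joined to a light set, so the
  size of \<open>diff i\<close> cancels from the bound.\<close>

lemma card_rows:
  assumes "i \<in> I"
  shows "2 ^ (n - t - 1) \<le> card (rows i)"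
proof -
  have "bij_betw (\<lambda>(A, B). A \<union> B) (Pow ({..<n} - diff i) \<times> light i) (rows i)"
  proof (rule bij_betw_byWitness[where f' = "\<lambda>P. (P - diff i, P \<inter> diff i)"])
    show "(\<lambda>(A, B). A \<union> B) ` (Pow ({..<n} - diff i) \<times> light i) \<subseteq> rows i"
    proof clarify
      fix A B assume "A \<subseteq> {..<n} - diff i" "B \<in> light i"
      moreover from this have "(A \<union> B) \<inter> diff i = B" by (auto simp: light_def)
      ultimately show "A \<union> B \<in> rows i"
        using diff_subset by (auto simp: rows_def light_def)
    qed
  qed (auto simp: rows_def light_def)
  then have "card (rows i) = 2 ^ (n - card (diff i)) * card (light i)"
    using diff_subset[of i] finite_diff[of i]
    by (simp add: bij_betw_same_card[symmetric] card_cartesian_product card_Pow card_Diff_subset)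
  moreover have "n - card (diff i) + (card (diff i) - t - 1) = n - t - 1"
    using card_diff[OF assms] card_mono[OF _ diff_subset[of i]] by simp
  ultimately show ?thesis
    using card_light[OF assms] by (metis mult_le_mono2 power_add)
qed

text \<open>A nonzero pairing makes \<open>P\<close> and \<open>Q\<close> disjoint and leaves a set
  \<open>C\<close> of at most \<open>t\<close> coordinates uncovered. Add the two lightness
  inequalities for this \<open>C\<close> and use that \<open>P\<close>, \<open>Q\<close> and
  \<open>C\<close> partition \<open>{..<n}\<close>.\<close>

lemma level_add_pos:
  assumes ij: "i \<in> I" "j \<in> I" "i \<noteq> j" and PQ: "P \<in> rows i" "Q \<in> rows j"
    and nz: "pairing i P j Q \<noteq> 0"
  shows "0 < level i P + level j Q"
proof -
  note entry_nz = prod_entry_nonzero[OF finite_lessThan nz]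
  have sub: "P \<subseteq> {..<n}" "Q \<subseteq> {..<n}" and fin: "finite P" "finite Q"
    using PQ by (auto simp: rows_def intro: finite_subset)
  define C where "C = {..<n} - (P \<union> Q)"
  have "card C \<le> hamming_dist n (a j) (b i)"
    unfolding hamming_dist_def C_def using entry_nz(2) by (intro card_mono) auto
  then have C: "C \<subseteq> {..<n}" "card C \<le> t"
    using near[of j i] ij by (auto simp: C_def)
  have "2 * weight (P \<inter> diff i) + weight C < weight (diff i)"
       "2 * weight (Q \<inter> diff j) + weight C < weight (diff j)"
    using PQ C by (auto simp: rows_def light_def)
  moreover have "weight (A - diff l) = weight A - weight (A \<inter> diff l)" if "finite A" for A l
    using weight_Diff[OF that, of "A \<inter> diff l"] by (simp add: Diff_Int)
  moreover have "weight C = weight {..<n} - (weight P + weight Q)"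
  proof -
    have "P \<inter> Q = {}" using entry_nz(1) sub by auto
    then show ?thesis
      using sub fin unfolding C_def by (subst weight_Diff) (auto simp: weight_disjoint)
  qed
  ultimately show ?thesis
    using fin diff_subset unfolding level_def by (simp add: weight_Diff)
qed

text \<open>Choose a row of maximal level in the support of \<open>c\<close>. Suitable columns of
  opposite level meet, by \<open>level_add_pos\<close>, only rows of the same index, which leaves a
  nonsingular diagonal block.\<close>

lemma rows_independent:
  assumes rel: "\<And>j Q. j \<in> I \<Longrightarrow> Q \<in> rows j \<Longrightarrow>
      (\<Sum>(i, P)\<in>Sigma I rows. c (i, P) * pairing i P j Q) = 0"
    and "p \<in> Sigma I rows"
  shows "c p = 0"
proof (rule ccontr)
  assume "c p \<noteq> 0"
  have fin: "finite (Sigma I rows)" using finite_I finite_rows by auto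
  define N where "N = {p \<in> Sigma I rows. c p \<noteq> 0}"
  have "finite N" "N \<noteq> {}" using fin \<open>p \<in> _\<close> \<open>c p \<noteq> 0\<close> by (auto simp: N_def)
  then have "Max (case_prod level ` N) \<in> case_prod level ` N" by (intro Max_in) auto
  then obtain q where "q \<in> N" "Max (case_prod level ` N) = case_prod level q" by (elim imageE)
  with \<open>finite N\<close> have q: "q \<in> N" "\<And>q'. q' \<in> N \<Longrightarrow> case_prod level q' \<le> case_prod level q"
    by (metis Max_ge finite_imageI imageI)+
  obtain i P where qiP: "q = (i, P)" by force
  have iP: "i \<in> I" "P \<in> rows i" "c (i, P) \<noteq> 0" using q(1) by (auto simp: N_def qiP)
  let ?D = "diff i" and ?x = "\<lambda>k. a i k - b i k"
  let ?E = "{..<n} - diff i"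
  define A where "A = P - ?D"
  have A: "A \<subseteq> ?E" using iP by (auto simp: A_def rows_def)
  have row: "B \<union> S \<in> rows i" if "B \<subseteq> ?E" "S \<in> light i" for B S
  proof -
    have "(B \<union> S) \<inter> ?D = S" using that by (auto simp: light_def)
    then show ?thesis using that diff_subset by (auto simp: rows_def light_def)
  qed
  have "(\<Sum>S\<in>light i. c (i, A \<union> S) * (\<Prod>k\<in>?D. entry S T ?x k)) = 0" if T: "T \<in> light i" for T
  proof -
    \<comment> \<open>Complementing \<open>A\<close> in \<open>?E\<close> negates the level, while
      \<open>T\<close> ranges over the columns of the block.\<close>
    define Q where "Q = (?E - A) \<union> T"
    have TD: "T \<subseteq> ?D" using T by (auto simp: light_def)
    have Q: "Q \<in> rows i" unfolding Q_def using T by (intro row) auto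
    have "Q - ?D = ?E - A" using TD by (auto simp: Q_def)
    then have "level i Q = - level i P"
      using A by (simp add: level_def A_def weight_Diff)
    have vanish: "c (j, S) * pairing j S i Q = 0"
      if "(j, S) \<in> Sigma I rows" "(j, S) \<notin> (\<lambda>S. (i, A \<union> S)) ` light i" for j S
    proof (rule ccontr)
      assume "c (j, S) * pairing j S i Q \<noteq> 0"
      then have nz: "c (j, S) \<noteq> 0" "pairing j S i Q \<noteq> 0" by auto
      have "(j, S) \<in> N" using that(1) nz(1) by (simp add: N_def)
      from q(2)[OF this] have "level j S + level i Q \<le> 0"
        using \<open>level i Q = _\<close> by (simp add: qiP)
      then have "j = i" using level_add_pos[OF _ iP(1) _ _ Q nz(2)] that(1) by fastforce
      have "S - ?D = A"
      proof -
        \<comment> \<open>Outside \<open>?D\<close> the letters agree, so a nonzero factor needs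
          exactly one wildcard.\<close>
        have "k \<in> S \<longleftrightarrow> k \<notin> Q" if "k \<in> ?E" for k
          using prod_entry_nonzero[OF finite_lessThan nz(2), of k] that \<open>j = i\<close>
          by (auto simp: diff_def)
        moreover have "S \<subseteq> {..<n}" using that(1) by (auto simp: rows_def)
        ultimately show ?thesis using A TD by (auto simp: Q_def)
      qed
      then have "S = A \<union> (S \<inter> ?D)" by auto
      moreover have "S \<inter> ?D \<in> light i" using that(1) \<open>j = i\<close> by (auto simp: rows_def)
      ultimately show False using that(2) \<open>j = i\<close> by (metis image_eqI)
    qed
    have inj: "inj_on (\<lambda>S. (i, A \<union> S)) (light i)"
      using A by (intro inj_on_inverseI[where g = "\<lambda>(_, S). S \<inter> ?D"]) (auto simp: light_def)
    have "pairing i (A \<union> S) i Q = (\<Prod>k\<in>?D. entry S T ?x k)" if "S \<in> light i" for S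
    proof -
      have "pairing i (A \<union> S) i Q =
          (\<Prod>k\<in>?E. entry (A \<union> S) Q ?x k) * (\<Prod>k\<in>?D. entry (A \<union> S) Q ?x k)"
        using diff_subset by (intro prod.subset_diff) auto
      also have "(\<Prod>k\<in>?E. entry (A \<union> S) Q ?x k) = 1"
        using that TD by (intro prod.neutral) (auto simp: entry_def Q_def light_def)
      also have "(\<Prod>k\<in>?D. entry (A \<union> S) Q ?x k) = (\<Prod>k\<in>?D. entry S T ?x k)"
        using A by (intro prod.cong) (auto simp: entry_def Q_def)
      finally show ?thesis by simp
    qed
    then have "(\<Sum>S\<in>light i. c (i, A \<union> S) * (\<Prod>k\<in>?D. entry S T ?x k)) =
        (\<Sum>S\<in>light i. c (i, A \<union> S) * pairing i (A \<union> S) i Q)"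
      by (intro sum.cong) auto
    also have "\<dots> = (\<Sum>(j, S)\<in>(\<lambda>S. (i, A \<union> S)) ` light i. c (j, S) * pairing j S i Q)"
      using inj by (simp add: sum.reindex)
    also have "\<dots> = (\<Sum>(j, S)\<in>Sigma I rows. c (j, S) * pairing j S i Q)"
      using fin iP(1) row A vanish by (intro sum.mono_neutral_left) auto
    also have "\<dots> = 0" using rel iP(1) Q by simp
    finally show ?thesis .
  qed
  note block_relations = this
  have nz: "?x k \<noteq> 0" if "k \<in> ?D" for k using that by (simp add: diff_def)
  have light: "light i \<subseteq> Pow ?D" "P \<inter> ?D \<in> light i" using iP by (auto simp: light_def rows_def)
  have "c (i, A \<union> (P \<inter> ?D)) = 0"
    by (rule down_closed_entry_nonsingular[where c = "\<lambda>S. c (i, A \<union> S)",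
        OF finite_diff nz light(1) _ block_relations light(2)]) (blast intro: light_down_closed)+
  moreover have "A \<union> (P \<inter> ?D) = P" by (auto simp: A_def)
  ultimately show False using iP(3) by simp
qed

lemma card_le:
  assumes "t < n"
  shows "card I \<le> 2 ^ (t + 1)"
proof -
  let ?J = "Sigma I rows"
  have finJ: "finite ?J" using finite_I finite_rows by auto
  have "card ?J \<le> 2 ^ n"
  proof (rule ccontr)
    assume "\<not> card ?J \<le> 2 ^ n"
    then have less: "card (Pow {..<n}) < card ?J" by (simp add: card_Pow)
    obtain u v where uv: "\<And>P Q x y. (\<Prod>k<n. entry P Q (\<lambda>k. x k - y k) k)
        = (\<Sum>Z\<in>Pow {..<n}. u P y Z * v Q x Z)"
      using prod_entry_factorization[of "{..<n}"] by auto
    \<comment> \<open>A relation among the row vectors \<open>u\<close>, which have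
      \<open>2 ^ n\<close> coordinates, annihilates every column.\<close>
    obtain c where c: "\<exists>p\<in>?J. c p \<noteq> 0"
      "\<forall>Z\<in>Pow {..<n}. (\<Sum>p\<in>?J. c p * u (snd p) (b (fst p)) Z) = 0"
      using nontrivial_linear_relation[OF _ finJ less, of "\<lambda>p. u (snd p) (b (fst p))"] by auto
    have "(\<Sum>(i, P)\<in>?J. c (i, P) * pairing i P j Q) = 0" for j Q
    proof -
      have "(\<Sum>(i, P)\<in>?J. c (i, P) * pairing i P j Q) =
          (\<Sum>p\<in>?J. \<Sum>Z\<in>Pow {..<n}. c p * u (snd p) (b (fst p)) Z * v Q (a j) Z)"
        by (intro sum.cong) (auto simp: uv sum_distrib_left mult.assoc)
      also have "\<dots> = (\<Sum>Z\<in>Pow {..<n}. (\<Sum>p\<in>?J. c p * u (snd p) (b (fst p)) Z) * v Q (a j) Z)"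
        unfolding sum_distrib_right by (rule sum.swap)
      also have "\<dots> = 0" using c(2) by (intro sum.neutral) auto
      finally show ?thesis .
    qed
    then show False using rows_independent[of c] c(1) by blast
  qed
  moreover have "card I * 2 ^ (n - t - 1) \<le> card ?J"
  proof -
    have "card I * 2 ^ (n - t - 1) = (\<Sum>i\<in>I. 2 ^ (n - t - 1))" by simp
    also have "\<dots> \<le> (\<Sum>i\<in>I. card (rows i))" by (intro sum_mono card_rows)
    finally show ?thesis using finite_I finite_rows by simp
  qed
  ultimately have "card I * 2 ^ (n - t - 1) \<le> 2 ^ n" by linarith
  also have "(2::nat) ^ n = 2 ^ (t + 1) * 2 ^ (n - t - 1)"
    using assms power_add[of "2::nat" "t + 1" "n - t - 1"] by simp
  finally show ?thesis by simp
qed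

end

section \<open>Arbitrary alphabets and the extremal value\<close>

lemma hamming_dist_map:
  assumes "inj_on f V" "\<And>k. k < n \<Longrightarrow> p k \<in> V \<and> q k \<in> V"
  shows "hamming_dist n (\<lambda>k. f (p k)) (\<lambda>k. f (q k)) = hamming_dist n p q"
  unfolding hamming_dist_def
  using assms by (intro arg_cong[of _ _ card]) (auto simp: inj_on_eq_iff)

lemma attainable_le:
  assumes "attainable t X m"
  shows "m \<le> 2 ^ (t + 1)"
proof -
  obtain n and a b :: "nat \<Rightarrow> nat \<Rightarrow> 'a" where n: "n > t"
    and far: "\<forall>i\<in>{1..m}. t + 1 \<le> hamming_dist n (a i) (b i)"
    and near: "\<forall>i\<in>{1..m}. \<forall>j\<in>{1..m}. i \<noteq> j \<longrightarrow> hamming_dist n (a i) (b j) \<le> t"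
    using assms unfolding attainable_def by blast
  \<comment> \<open>\<open>X\<close> may be too large to embed in the reals, but only finitely many
    letters occur, and distances depend only on equality of letters.\<close>
  define V where "V = (\<Union>i\<in>{1..m}. a i ` {..<n} \<union> b i ` {..<n})"
  have "finite V" by (auto simp: V_def)
  then obtain f :: "'a \<Rightarrow> nat" where f: "inj_on f V"
    using finite_imp_inj_to_nat_seg by metis
  define g where "g = real \<circ> f"
  have g: "inj_on g V" using f by (auto simp: g_def inj_on_def)
  have dist: "hamming_dist n (\<lambda>k. g (a i k)) (\<lambda>k. g (b j k)) = hamming_dist n (a i) (b j)"
    if "i \<in> {1..m}" "j \<in> {1..m}" for i j
    using that by (intro hamming_dist_map[OF g]) (auto simp: V_def)
  interpret separated_pairs n t "{1..m}" "\<lambda>i k. g (a i k)" "\<lambda>i k. g (b i k)"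
    by unfold_locales (use far near in \<open>simp_all add: dist\<close>)
  show ?thesis using card_le[OF n] by simp
qed

lemma attainable_two_power:
  assumes "x \<in> X" "y \<in> X" "x \<noteq> y"
  shows "attainable t X (2 ^ (t + 1))"
proof -
  obtain S where S: "bij_betw S {1..card (Pow {..<t + 1})} (Pow {..<t + 1})"
    using ex_bij_betw_nat_finite_1[of "Pow {..<t + 1}"] by auto
  let ?m = "2 ^ (t + 1) :: nat"
  have S: "bij_betw S {1..?m} (Pow {..<t + 1})"
    using S by (simp only: card_Pow finite_lessThan card_lessThan)
  define a where "a i = (\<lambda>k\<in>{..<t + 1}. if k \<in> S i then x else y)" for i
  define b where "b i = (\<lambda>k\<in>{..<t + 1}. if k \<in> S i then y else x)" for i
  \<comment> \<open>As \<open>b j\<close> is the complement of \<open>a j\<close>, differing from it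
    means agreeing with \<open>a j\<close>.\<close>
  have dist: "hamming_dist (t + 1) (a i) (b j) = card {k \<in> {..<t + 1}. k \<in> S i \<longleftrightarrow> k \<in> S j}" for i j
    unfolding hamming_dist_def using assms(3)
    by (intro arg_cong[of _ _ card]) (auto simp: a_def b_def)
  have "hamming_dist (t + 1) (a i) (b j) \<le> t"
    if "i \<in> {1..?m}" "j \<in> {1..?m}" "i \<noteq> j" for i j
  proof -
    have "S i \<noteq> S j" "S i \<subseteq> {..<t + 1}" "S j \<subseteq> {..<t + 1}"
      using S that unfolding bij_betw_def inj_on_def by blast+
    then have "{k \<in> {..<t + 1}. k \<in> S i \<longleftrightarrow> k \<in> S j} \<subset> {..<t + 1}" by blast
    then have "card {k \<in> {..<t + 1}. k \<in> S i \<longleftrightarrow> k \<in> S j} < card {..<t + 1}"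
      by (intro psubset_card_mono) auto
    then show ?thesis unfolding dist by simp
  qed
  moreover have "hamming_dist (t + 1) (a i) (b i) \<ge> t + 1" for i
    unfolding dist by simp
  moreover have "a i \<in> {..<t + 1} \<rightarrow>\<^sub>E X" "b i \<in> {..<t + 1} \<rightarrow>\<^sub>E X" for i
    using assms by (auto simp: a_def b_def)
  ultimately show ?thesis
    unfolding attainable_def by (intro exI[of _ "t + 1"] conjI exI[of _ a] exI[of _ b]) auto
qed

theorem theorem1p5:
  fixes t :: nat and X :: "'a set"
  assumes "infinite X \<or> card X \<ge> 2"
  shows "attainable t X (max_pairs t X) \<and>
         (\<forall>m. attainable t X m \<longrightarrow> m \<le> max_pairs t X) \<and>
         max_pairs t X = 2 ^ (t + 1)"
proof -
  obtain S where "S \<subseteq> X" "card S = 2"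
    using assms infinite_arbitrarily_large[of X 2] obtain_subset_with_card_n[of 2 X] by blast
  then obtain x y where "x \<in> X" "y \<in> X" "x \<noteq> y"
    by (auto simp: card_2_iff)
  then have "attainable t X (2 ^ (t + 1))" by (rule attainable_two_power)
  moreover from this have "max_pairs t X = 2 ^ (t + 1)"
    unfolding max_pairs_def by (intro Greatest_equality attainable_le)
  ultimately show ?thesis using attainable_le by metis
qed

end
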